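(* Let $\vec{e}_0,\vec{e}_1,\ldots$ be the standard orthonormal basis of $\ell^2$ (complex square-summable sequences), let $S$ be the unilateral shift $S\vec{e}_i=\vec{e}_{i+1}$ for $i\geq 0$, with adjoint given by $S^*\vec{e}_i=\vec{e}_{i-1}$ for $i\geq 1$ and $S^*\vec{e}_0=\vec{0}$, and let $M=\operatorname{diag}(\mu_0,\mu_1,\ldots)$ be a bounded diagonal operator on $\ell^2$, i.e. $M\vec{e}_i=\mu_i\vec{e}_i$ for $i\geq 0$ with $\mu_i\in\mathbb{C}$. Then: (a) $\frac{1}{\sqrt{2}}\|M\|\leq\|S^*\odot M\|\leq\|M\|$, and both inequalities are sharp (each holds with equality for some nonzero bounded diagonal $M$). (b) $\{z\in\mathbb{C}:|z|<\frac{1}{2}|\mu_0|\}\cup\{0\}\subseteq\sigma_{\mathrm{p}}(S^*\odot M)$.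
   Context: $\sigma_{\mathrm{p}}(T)$ denotes the point spectrum (set of eigenvalues) of $T$. For $\mathcal{H}=\ell^2$, let $\mathcal{H}\otimes\mathcal{H}$ be the Hilbert-space tensor product and let $\hat\pi$ be the unitary flip on it, determined by $\hat\pi(\vec{u}\otimes\vec{v})=\vec{v}\otimes\vec{u}$. The symmetric tensor power is the closed subspace $\mathcal{H}\odot\mathcal{H}=\{\vec{x}\in\mathcal{H}\otimes\mathcal{H}:\hat\pi\vec{x}=\vec{x}\}$. For bounded operators $A,B$ on $\mathcal{H}$, $A\otimes B$ is the bounded operator on $\mathcal{H}\otimes\mathcal{H}$ with $(A\otimes B)(\vec{u}\otimes\vec{v})=A\vec{u}\otimes B\vec{v}$, and the symmetric tensor product $A\odot B$ is the restriction of $\frac{1}{2}(A\otimes B+B\otimes A)$ to $\mathcal{H}\odot\mathcal{H}$, which is invariant under it, regarded as an operator on $\mathcal{H}\odot\mathcal{H}$. *)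

theory Defs
  imports "HOL-Analysis.Analysis"
begin

section \<open>Complex inner product spaces and operators\<close>

text \<open>The inner product is linear in the first argument.\<close>

class complex_inner = real_normed_vector +
  fixes scaleC :: "complex \<Rightarrow> 'a \<Rightarrow> 'a" (infixr "*\<^sub>C" 75)
    and cinner :: "'a \<Rightarrow> 'a \<Rightarrow> complex"
  assumes scaleC_add_right: "a *\<^sub>C (x + y) = a *\<^sub>C x + a *\<^sub>C y"
    and scaleC_add_left: "(a + b) *\<^sub>C x = a *\<^sub>C x + b *\<^sub>C x"
    and scaleC_scaleC: "a *\<^sub>C b *\<^sub>C x = (a * b) *\<^sub>C x"
    and scaleC_of_real: "complex_of_real r *\<^sub>C x = r *\<^sub>R x"
    and cinner_commute: "cinner x y = cnj (cinner y x)"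
    and cinner_add_left: "cinner (x + y) z = cinner x z + cinner y z"
    and cinner_scaleC_left: "cinner (a *\<^sub>C x) y = a * cinner x y"
    and norm_eq_sqrt_cinner: "norm x = sqrt (Re (cinner x x))"

class chilbert_space = complex_inner + complete_space

definition bounded_clinear :: "('a::complex_inner \<Rightarrow> 'b::complex_inner) \<Rightarrow> bool" where
  "bounded_clinear T \<longleftrightarrow> bounded_linear T \<and> (\<forall>c x. T (c *\<^sub>C x) = c *\<^sub>C T x)"

definition cadjoint :: "('a::complex_inner \<Rightarrow> 'b::complex_inner) \<Rightarrow> 'b \<Rightarrow> 'a" where
  "cadjoint A = (THE B. \<forall>x y. cinner (A x) y = cinner x (B y))"

definition point_spectrum :: "('a::complex_inner \<Rightarrow> 'a) \<Rightarrow> complex set" where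
  "point_spectrum T = {z. \<exists>x. x \<noteq> 0 \<and> T x = z *\<^sub>C x}"

lemma scaleC_zero_left [simp]: "0 *\<^sub>C (x::'a::complex_inner) = 0"
  using scaleC_of_real[of 0 x] by simp

lemma scaleC_one [simp]: "1 *\<^sub>C (x::'a::complex_inner) = x"
  using scaleC_of_real[of 1 x] by simp

lemma scaleC_zero_right [simp]: "a *\<^sub>C (0::'a::complex_inner) = 0"
  using scaleC_add_right[of a 0 "0::'a"] by simp

lemma scaleC_minus_right: "a *\<^sub>C (- x) = - (a *\<^sub>C (x::'a::complex_inner))"
  using scaleC_add_right[of a x "- x"] by (simp add: eq_neg_iff_add_eq_0 add.commute)

lemma scaleC_diff_right: "a *\<^sub>C (x - y) = a *\<^sub>C x - a *\<^sub>C (y::'a::complex_inner)"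
  using scaleC_add_right[of a x "- y"] by (simp add: scaleC_minus_right)

lemma cinner_zero_left [simp]: "cinner 0 (x::'a::complex_inner) = 0"
  using cinner_add_left[of 0 0 x] by simp

lemma cinner_diff_left: "cinner (x - y) z = cinner x z - cinner y (z::'a::complex_inner)"
  using cinner_add_left[of "x - y" y z] by simp

lemma cinner_diff_right: "cinner x (y - z) = cinner x y - cinner x (z::'a::complex_inner)"
  by (metis cinner_commute cinner_diff_left complex_cnj_diff)

lemma cinner_self: "cinner x (x::'a::complex_inner) = complex_of_real ((norm x)\<^sup>2)"
proof -
  have "Im (cinner x x) = 0"
    using arg_cong[OF cinner_commute[of x x], of Im] by simp
  moreover have "Re (cinner x x) = (norm x)\<^sup>2"
    using norm_ge_zero[of x] unfolding norm_eq_sqrt_cinner by simp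
  ultimately show ?thesis by (simp add: complex_eq_iff)
qed

lemma norm_scaleC: "norm (a *\<^sub>C (x::'a::complex_inner)) = cmod a * norm x"
proof -
  have "cinner (a *\<^sub>C x) (a *\<^sub>C x) = (a * cnj a) * cinner x x"
    by (metis cinner_commute cinner_scaleC_left complex_cnj_mult mult.assoc)
  then have "complex_of_real ((norm (a *\<^sub>C x))\<^sup>2) = complex_of_real ((cmod a * norm x)\<^sup>2)"
    by (simp add: cinner_self complex_norm_square[symmetric] power_mult_distrib
        del: of_real_power)
  then have "(norm (a *\<^sub>C x))\<^sup>2 = (cmod a * norm x)\<^sup>2"
    using of_real_eq_iff by blast
  then show ?thesis by simp
qed

lemma bounded_clinearI:
  assumes "\<And>x y. T (x + y) = T x + T y" "\<And>c x. T (c *\<^sub>C x) = c *\<^sub>C T x"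
    "\<And>x. norm (T x) \<le> K * norm x"
  shows "bounded_clinear T"
proof -
  have "bounded_linear T"
    by (rule bounded_linear_intro[where K = K])
      (use assms in \<open>auto simp: scaleC_of_real[symmetric] mult.commute\<close>)
  then show ?thesis using assms by (simp add: bounded_clinear_def)
qed

lemma cadjoint_eqI:
  assumes "\<And>x y. cinner (A x) y = cinner x (B y)"
  shows "cadjoint A = B"
  unfolding cadjoint_def
proof (rule the_equality)
  fix C assume C: "\<forall>x y. cinner (A x) y = cinner x (C y)"
  show "C = B"
  proof
    fix y
    have "cinner (C y - B y) (C y - B y) = 0"
      using C assms cinner_diff_right[of "C y - B y" "C y" "B y"] by simp
    then show "C y = B y" by (simp add: cinner_self)
  qed
qed (use assms in auto)

section \<open>The Hilbert space of square-summable families\<close>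

lemma square_summable_iff:
  "(\<lambda>i. (cmod (x i))\<^sup>2) summable_on UNIV \<longleftrightarrow>
    (\<exists>b. \<forall>F. finite F \<longrightarrow> L2_set (\<lambda>i. cmod (x i)) F \<le> b)" (is "?L = ?R")
proof
  assume L: ?L
  have "L2_set (\<lambda>i. cmod (x i)) F \<le> sqrt (\<Sum>\<^sub>\<infinity>i. (cmod (x i))\<^sup>2)" if "finite F" for F
    unfolding L2_set_def using finite_sum_le_infsum[OF L that] by simp
  then show ?R by blast
next
  assume ?R
  then obtain b where b: "\<And>F. finite F \<Longrightarrow> L2_set (\<lambda>i. cmod (x i)) F \<le> b" by blast
  have "(\<Sum>i\<in>F. (cmod (x i))\<^sup>2) \<le> b\<^sup>2" if "finite F" for F
    using power_mono[OF b[OF that], of 2] by (simp add: L2_set_def sum_nonneg)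
  then show ?L
    by (intro nonneg_bdd_above_summable_on) (auto intro!: bdd_aboveI)
qed

typedef 'i ell2 = "{x :: 'i \<Rightarrow> complex. (\<lambda>i. (cmod (x i))\<^sup>2) summable_on UNIV}"
  morphisms coord Abs_ell2
  by (rule exI[of _ "\<lambda>_. 0"]) simp

setup_lifting type_definition_ell2

lemma ell2_eqI: "(\<And>i. coord x i = coord y i) \<Longrightarrow> x = y"
  by (metis coord_inject ext)

lemma coord_summable: "(\<lambda>i. (cmod (coord x i))\<^sup>2) summable_on UNIV"
  using coord by blast

lemma L2_set_cmod_add_le:
  "L2_set (\<lambda>i. cmod (f i + g i)) F \<le> L2_set (\<lambda>i. cmod (f i)) F + L2_set (\<lambda>i. cmod (g i)) F"
  by (rule order_trans[OF L2_set_mono L2_set_triangle_ineq]) (auto intro: norm_triangle_ineq)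

lemma L2_set_cmod_mult: "L2_set (\<lambda>i. cmod (c * f i)) F = cmod c * L2_set (\<lambda>i. cmod (f i)) F"
  by (simp add: norm_mult L2_set_right_distrib)

lemma square_summable_add:
  assumes "(\<lambda>i. (cmod (f i))\<^sup>2) summable_on UNIV" "(\<lambda>i. (cmod (g i))\<^sup>2) summable_on UNIV"
  shows "(\<lambda>i. (cmod (f i + g i))\<^sup>2) summable_on UNIV"
proof -
  obtain a b where "\<And>F. finite F \<Longrightarrow> L2_set (\<lambda>i. cmod (f i)) F \<le> a"
    "\<And>F. finite F \<Longrightarrow> L2_set (\<lambda>i. cmod (g i)) F \<le> b"
    using assms unfolding square_summable_iff by blast
  then have "L2_set (\<lambda>i. cmod (f i + g i)) F \<le> a + b" if "finite F" for F
    using L2_set_cmod_add_le[of f g F] that by (meson add_mono order_trans)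
  then show ?thesis unfolding square_summable_iff by blast
qed

lemma square_summable_mult:
  assumes "(\<lambda>i. (cmod (f i))\<^sup>2) summable_on UNIV"
  shows "(\<lambda>i. (cmod (c * f i))\<^sup>2) summable_on UNIV"
  using summable_on_cmult_right[OF assms, of "(cmod c)\<^sup>2"]
  by (simp add: norm_mult power_mult_distrib)

instantiation ell2 :: (type) real_normed_vector
begin

lift_definition zero_ell2 :: "'a ell2" is "\<lambda>_. 0" by simp
lift_definition plus_ell2 :: "'a ell2 \<Rightarrow> 'a ell2 \<Rightarrow> 'a ell2" is "\<lambda>x y i. x i + y i"
  by (rule square_summable_add)
lift_definition uminus_ell2 :: "'a ell2 \<Rightarrow> 'a ell2" is "\<lambda>x i. - x i" by simp
lift_definition minus_ell2 :: "'a ell2 \<Rightarrow> 'a ell2 \<Rightarrow> 'a ell2" is "\<lambda>x y i. x i - y i"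
  subgoal for x y using square_summable_add[of x "\<lambda>i. - y i"] by simp
  done
lift_definition scaleR_ell2 :: "real \<Rightarrow> 'a ell2 \<Rightarrow> 'a ell2" is "\<lambda>r x i. complex_of_real r * x i"
  by (rule square_summable_mult)
lift_definition norm_ell2 :: "'a ell2 \<Rightarrow> real" is "\<lambda>x. sqrt (\<Sum>\<^sub>\<infinity>i. (cmod (x i))\<^sup>2)" .
definition dist_ell2 :: "'a ell2 \<Rightarrow> 'a ell2 \<Rightarrow> real" where "dist_ell2 x y = norm (x - y)"
definition sgn_ell2 :: "'a ell2 \<Rightarrow> 'a ell2" where "sgn_ell2 x = inverse (norm x) *\<^sub>R x"
definition uniformity_ell2 :: "('a ell2 \<times> 'a ell2) filter" where
  "uniformity_ell2 = (INF e\<in>{0 <..}. principal {(x, y). dist x y < e})"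
definition open_ell2 :: "'a ell2 set \<Rightarrow> bool" where
  "open_ell2 U = (\<forall>x\<in>U. \<forall>\<^sub>F (x', y) in uniformity. x' = x \<longrightarrow> y \<in> U)"

lemma L2_set_le_norm: "finite F \<Longrightarrow> L2_set (\<lambda>i. cmod (coord x i)) F \<le> norm (x :: 'a ell2)"
  unfolding L2_set_def norm_ell2.rep_eq
  using finite_sum_le_infsum[OF coord_summable, of F x] by simp

lemma norm_ell2_leI:
  assumes "\<And>F. finite F \<Longrightarrow> L2_set (\<lambda>i. cmod (coord x i)) F \<le> b"
  shows "norm (x :: 'a ell2) \<le> b"
proof -
  have "0 \<le> b" using assms[of "{}"] by simp
  have "(\<Sum>i\<in>F. (cmod (coord x i))\<^sup>2) \<le> b\<^sup>2" if "finite F" for F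
    using power_mono[OF assms[OF that], of 2] by (simp add: L2_set_def sum_nonneg)
  then have "(\<Sum>\<^sub>\<infinity>i. (cmod (coord x i))\<^sup>2) \<le> b\<^sup>2"
    by (intro infsum_le_finite_sums[OF coord_summable]) auto
  then have "sqrt (\<Sum>\<^sub>\<infinity>i. (cmod (coord x i))\<^sup>2) \<le> sqrt (b\<^sup>2)" by (rule real_sqrt_le_mono)
  then show ?thesis
    using \<open>0 \<le> b\<close> by (simp add: norm_ell2.rep_eq)
qed

instance
proof
  fix x y z :: "'a ell2" and a b :: real
  show "x + y + z = x + (y + z)" by transfer (simp add: add.assoc)
  show "x + y = y + x" by transfer (simp add: add.commute)
  show "0 + x = x" by transfer simp
  show "- x + x = 0" by transfer simp
  show "x - y = x + - y" by transfer simp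
  show "a *\<^sub>R (x + y) = a *\<^sub>R x + a *\<^sub>R y" by transfer (simp add: distrib_left)
  show "(a + b) *\<^sub>R x = a *\<^sub>R x + b *\<^sub>R x" by transfer (simp add: distrib_right)
  show "a *\<^sub>R b *\<^sub>R x = (a * b) *\<^sub>R x" by transfer (simp add: mult.assoc)
  show "1 *\<^sub>R x = x" by transfer simp
  show "dist x y = norm (x - y)" by (simp add: dist_ell2_def)
  show "sgn x = inverse (norm x) *\<^sub>R x" by (simp add: sgn_ell2_def)
  show "uniformity = (INF e\<in>{0 <..}. principal {(x, y :: 'a ell2). dist x y < e})"
    by (simp add: uniformity_ell2_def)
  show "open U = (\<forall>x\<in>U. \<forall>\<^sub>F (x', y) in uniformity. x' = x \<longrightarrow> y \<in> U)" for U :: "'a ell2 set"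
    by (simp add: open_ell2_def)
  show "norm x = 0 \<longleftrightarrow> x = 0"
  proof
    assume "norm x = 0"
    then have "cmod (coord x i) \<le> 0" for i
      using L2_set_le_norm[of "{i}" x] by simp
    then show "x = 0" by (intro ell2_eqI) (simp add: zero_ell2.rep_eq)
  qed (simp add: norm_ell2.rep_eq zero_ell2.rep_eq)
  show "norm (x + y) \<le> norm x + norm y"
  proof (rule norm_ell2_leI)
    fix F :: "'a set" assume "finite F"
    then show "L2_set (\<lambda>i. cmod (coord (x + y) i)) F \<le> norm x + norm y"
      using L2_set_cmod_add_le[of "coord x" "coord y" F] L2_set_le_norm[of F x]
        L2_set_le_norm[of F y] by (simp add: plus_ell2.rep_eq)
  qed
  show "norm (a *\<^sub>R x) = \<bar>a\<bar> * norm x"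
    by (simp add: norm_ell2.rep_eq scaleR_ell2.rep_eq norm_mult power_mult_distrib
        infsum_cmult_right' real_sqrt_mult)
qed

end


lemma norm_ell2_square: "(norm x)\<^sup>2 = (\<Sum>\<^sub>\<infinity>i. (cmod (coord x i))\<^sup>2)"
  by (simp add: norm_ell2.rep_eq infsum_nonneg)

lemma cmod_coord_le_norm: "cmod (coord x i) \<le> norm x"
  using L2_set_le_norm[of "{i}" x] by simp

lemma cinner_summable: "(\<lambda>i. coord x i * cnj (coord y i)) summable_on UNIV"
proof (rule abs_summable_summable, rule abs_summable_product)
  show "(\<lambda>i. norm (coord x i * coord x i)) summable_on UNIV"
    using coord_summable[of x] by (simp add: norm_mult power2_eq_square)
  show "(\<lambda>i. norm (cnj (coord y i) * cnj (coord y i))) summable_on UNIV"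
    using coord_summable[of y] by (simp add: norm_mult power2_eq_square)
qed

instantiation ell2 :: (type) complex_inner
begin

lift_definition scaleC_ell2 :: "complex \<Rightarrow> 'a ell2 \<Rightarrow> 'a ell2" is "\<lambda>c x i. c * x i"
  by (rule square_summable_mult)
lift_definition cinner_ell2 :: "'a ell2 \<Rightarrow> 'a ell2 \<Rightarrow> complex" is
  "\<lambda>x y. \<Sum>\<^sub>\<infinity>i. x i * cnj (y i)" .

instance
proof
  fix x y z :: "'a ell2" and a b :: complex and r :: real
  show "a *\<^sub>C (x + y) = a *\<^sub>C x + a *\<^sub>C y" by transfer (simp add: distrib_left)
  show "(a + b) *\<^sub>C x = a *\<^sub>C x + b *\<^sub>C x" by transfer (simp add: distrib_right)
  show "a *\<^sub>C b *\<^sub>C x = (a * b) *\<^sub>C x" by transfer (simp add: mult.assoc)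
  show "complex_of_real r *\<^sub>C x = r *\<^sub>R x" by transfer simp
  show "cinner x y = cnj (cinner y x)"
    by (simp add: cinner_ell2.rep_eq infsum_cnj[symmetric] mult.commute)
  show "cinner (x + y) z = cinner x z + cinner y z"
    by (simp add: cinner_ell2.rep_eq plus_ell2.rep_eq distrib_right infsum_add cinner_summable)
  show "cinner (a *\<^sub>C x) y = a * cinner x y"
    by (simp add: cinner_ell2.rep_eq scaleC_ell2.rep_eq mult.assoc infsum_cmult_right')
  show "norm x = sqrt (Re (cinner x x))"
    by (simp add: cinner_ell2.rep_eq norm_ell2.rep_eq infsum_Re[OF cinner_summable, symmetric]
        cmod_power2 power2_eq_square[symmetric])
qed

end

instance ell2 :: (type) chilbert_space
proof
  fix X :: "nat \<Rightarrow> 'a ell2" assume C: "Cauchy X"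
  have "Cauchy (\<lambda>n. coord (X n) i)" for i
  proof (rule metric_CauchyI)
    fix e :: real assume "0 < e"
    then obtain N where "\<forall>m\<ge>N. \<forall>n\<ge>N. dist (X m) (X n) < e"
      using metric_CauchyD[OF C] by meson
    moreover have "dist (coord (X m) i) (coord (X n) i) \<le> dist (X m) (X n)" for m n
      using cmod_coord_le_norm[of "X m - X n" i] by (simp add: dist_norm minus_ell2.rep_eq)
    ultimately show "\<exists>N. \<forall>m\<ge>N. \<forall>n\<ge>N. dist (coord (X m) i) (coord (X n) i) < e"
      by (meson le_less_trans)
  qed
  then have "\<forall>i. \<exists>a. (\<lambda>n. coord (X n) i) \<longlonglongrightarrow> a"
    by (simp add: Cauchy_convergent_iff convergent_def)
  then obtain l where l: "\<And>i. (\<lambda>n. coord (X n) i) \<longlonglongrightarrow> l i"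
    unfolding choice_iff by blast
  have *: "\<exists>N. \<forall>n\<ge>N. \<forall>F. finite F \<longrightarrow> L2_set (\<lambda>i. cmod (coord (X n) i - l i)) F \<le> e"
    if "0 < e" for e
  proof -
    obtain N where N: "\<And>m n. m \<ge> N \<Longrightarrow> n \<ge> N \<Longrightarrow> dist (X m) (X n) < e"
      using metric_CauchyD[OF C \<open>0 < e\<close>] by meson
    have "L2_set (\<lambda>i. cmod (coord (X n) i - l i)) F \<le> e" if "n \<ge> N" "finite F" for n F
    proof (rule LIMSEQ_le_const2)
      show "(\<lambda>m. L2_set (\<lambda>i. cmod (coord (X n) i - coord (X m) i)) F)
          \<longlonglongrightarrow> L2_set (\<lambda>i. cmod (coord (X n) i - l i)) F"
        unfolding L2_set_def by (intro tendsto_intros l)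
      have "L2_set (\<lambda>i. cmod (coord (X n) i - coord (X m) i)) F \<le> e" if "m \<ge> N" for m
        using L2_set_le_norm[OF \<open>finite F\<close>, of "X n - X m"] N[OF \<open>n \<ge> N\<close> that]
        by (simp add: dist_norm minus_ell2.rep_eq)
      then show "\<exists>N. \<forall>m\<ge>N. L2_set (\<lambda>i. cmod (coord (X n) i - coord (X m) i)) F \<le> e" by blast
    qed
    then show ?thesis by blast
  qed
  obtain N where N: "\<And>F. finite F \<Longrightarrow> L2_set (\<lambda>i. cmod (coord (X N) i - l i)) F \<le> 1"
    using *[of 1] by auto
  then have "(\<lambda>i. (cmod (coord (X N) i - l i))\<^sup>2) summable_on UNIV"
    unfolding square_summable_iff by blast
  from square_summable_add[OF coord_summable[of "X N"] square_summable_mult[OF this, of "-1"]]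
  have "(\<lambda>i. (cmod (l i))\<^sup>2) summable_on UNIV" by simp
  then have co: "coord (Abs_ell2 l) = l" by (simp add: Abs_ell2_inverse)
  have "X \<longlonglongrightarrow> Abs_ell2 l"
  proof (rule metric_LIMSEQ_I)
    fix e :: real assume "0 < e"
    then obtain N where
      "\<And>n F. n \<ge> N \<Longrightarrow> finite F \<Longrightarrow> L2_set (\<lambda>i. cmod (coord (X n) i - l i)) F \<le> e / 2"
      using *[of "e / 2"] by auto
    then have half: "norm (X n - Abs_ell2 l) \<le> e / 2" if "n \<ge> N" for n
      using that by (intro norm_ell2_leI) (simp add: minus_ell2.rep_eq co)
    have "dist (X n) (Abs_ell2 l) < e" if "n \<ge> N" for n
      unfolding dist_norm using half[OF that] \<open>0 < e\<close> by linarith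
    then show "\<exists>N. \<forall>n\<ge>N. dist (X n) (Abs_ell2 l) < e" by blast
  qed
  then show "convergent X" by (rule convergentI)
qed

lift_definition basis :: "'i \<Rightarrow> 'i ell2" is "\<lambda>i j. if j = i then 1 else 0"
  by (rule finite_nonzero_values_imp_summable_on) simp

lemma coord_sum: "coord (\<Sum>k\<in>F. f k) i = (\<Sum>k\<in>F. coord (f k) i)"
  by (induction F rule: infinite_finite_induct) (auto simp: zero_ell2.rep_eq plus_ell2.rep_eq)

lemma has_sum_basis: "((\<lambda>i. coord x i *\<^sub>C basis i) has_sum x) UNIV"
proof -
  have cs: "coord (\<Sum>i\<in>F. coord x i *\<^sub>C basis i) j = (if j \<in> F then coord x j else 0)"
    if "finite F" for F j
    using that by (simp add: coord_sum scaleC_ell2.rep_eq basis.rep_eq if_distrib cong: if_cong)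
  have nrm: "(dist (\<Sum>i\<in>F. coord x i *\<^sub>C basis i) x)\<^sup>2
      = (norm x)\<^sup>2 - (\<Sum>i\<in>F. (cmod (coord x i))\<^sup>2)" if "finite F" for F
  proof -
    have "(dist (\<Sum>i\<in>F. coord x i *\<^sub>C basis i) x)\<^sup>2
        = (\<Sum>\<^sub>\<infinity>j. (cmod ((if j \<in> F then coord x j else 0) - coord x j))\<^sup>2)"
      by (simp add: dist_norm norm_ell2_square minus_ell2.rep_eq cs[OF that])
    also have "\<dots> = (\<Sum>\<^sub>\<infinity>j\<in>UNIV - F. (cmod (coord x j))\<^sup>2)"
      by (rule infsum_cong_neutral) auto
    also have "\<dots> = (\<Sum>\<^sub>\<infinity>j. (cmod (coord x j))\<^sup>2) - (\<Sum>\<^sub>\<infinity>j\<in>F. (cmod (coord x j))\<^sup>2)"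
      by (rule infsum_Diff) (use coord_summable that in auto)
    finally show ?thesis using that by (simp add: norm_ell2_square)
  qed
  have "((\<lambda>F. \<Sum>i\<in>F. (cmod (coord x i))\<^sup>2) \<longlongrightarrow> (norm x)\<^sup>2) (finite_subsets_at_top UNIV)"
    using has_sum_infsum[OF coord_summable[of x]] by (simp add: has_sum_def norm_ell2_square)
  then have "((\<lambda>F. (norm x)\<^sup>2 - (\<Sum>i\<in>F. (cmod (coord x i))\<^sup>2)) \<longlongrightarrow> 0) (finite_subsets_at_top UNIV)"
    using tendsto_diff[OF tendsto_const[of "(norm x)\<^sup>2"]] by fastforce
  then have "((\<lambda>F. (dist (\<Sum>i\<in>F. coord x i *\<^sub>C basis i) x)\<^sup>2) \<longlongrightarrow> 0) (finite_subsets_at_top UNIV)"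
    by (rule Lim_transform_eventually)
      (auto simp: nrm intro!: eventually_finite_subsets_at_top_weakI)
  from tendsto_real_sqrt[OF this]
  have "((\<lambda>F. dist (\<Sum>i\<in>F. coord x i *\<^sub>C basis i) x) \<longlongrightarrow> 0) (finite_subsets_at_top UNIV)" by simp
  then show ?thesis unfolding has_sum_def by (rule tendsto_dist_iff[THEN iffD2])
qed

lemma bounded_clinear_eqI:
  assumes "bounded_clinear T" "bounded_clinear T'" "\<And>i. T (basis i) = T' (basis i)"
  shows "T = T'"
proof
  fix x
  have "((\<lambda>i. U (coord x i *\<^sub>C basis i)) has_sum U x) UNIV" if "bounded_clinear U"
    for U :: "'a ell2 \<Rightarrow> 'b"
    using has_sum_bounded_linear[OF _ has_sum_basis[of x], of U] that
    by (simp add: bounded_clinear_def comp_def)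
  from this[OF assms(1)] this[OF assms(2)] show "T x = T' x"
    using assms by (simp add: bounded_clinear_def has_sum_unique)
qed

section \<open>Shift and diagonal operators\<close>

lemma summable_shift:
  "(\<lambda>n. (cmod (x n))\<^sup>2) summable_on (UNIV :: nat set) \<Longrightarrow>
    (\<lambda>n. (cmod (case n of 0 \<Rightarrow> 0 | Suc m \<Rightarrow> x m))\<^sup>2) summable_on UNIV"
proof -
  assume "(\<lambda>n. (cmod (x n))\<^sup>2) summable_on (UNIV :: nat set)"
  then have "(\<lambda>n. (cmod (case n of 0 \<Rightarrow> 0 | Suc m \<Rightarrow> x m))\<^sup>2) summable_on range Suc"
    by (subst summable_on_reindex) (auto simp: comp_def)
  then show ?thesis
    by (rule summable_on_cong_neutral[THEN iffD1, rotated -1])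
      (auto split: nat.splits)
qed

lift_definition shift :: "nat ell2 \<Rightarrow> nat ell2" is "\<lambda>x n. case n of 0 \<Rightarrow> 0 | Suc m \<Rightarrow> x m"
  by (rule summable_shift)

lift_definition backward_shift :: "nat ell2 \<Rightarrow> nat ell2" is "\<lambda>x n. x (Suc n)"
proof -
  fix x :: "nat \<Rightarrow> complex" assume "(\<lambda>n. (cmod (x n))\<^sup>2) summable_on UNIV"
  then have "(\<lambda>n. (cmod (x n))\<^sup>2) summable_on range Suc"
    by (rule summable_on_subset_banach) simp
  then show "(\<lambda>n. (cmod (x (Suc n)))\<^sup>2) summable_on UNIV"
    by (subst (asm) summable_on_reindex) (auto simp: comp_def)
qed

lemma norm_shift: "norm (shift x) = norm x"
proof -
  have "(\<Sum>\<^sub>\<infinity>n. (cmod (coord (shift x) n))\<^sup>2) = (\<Sum>\<^sub>\<infinity>n\<in>range Suc. (cmod (coord (shift x) n))\<^sup>2)"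
    by (rule infsum_cong_neutral) (auto simp: shift.rep_eq split: nat.splits)
  then show ?thesis
    by (simp add: norm_ell2.rep_eq infsum_reindex comp_def shift.rep_eq)
qed

lemma norm_backward_shift: "norm (backward_shift x) \<le> norm x"
proof (rule norm_ell2_leI)
  fix F :: "nat set" assume "finite F"
  then show "L2_set (\<lambda>i. cmod (coord (backward_shift x) i)) F \<le> norm x"
    using L2_set_le_norm[of "Suc ` F" x]
    by (simp add: L2_set_def sum.reindex comp_def backward_shift.rep_eq)
qed

lemma bounded_clinear_shift: "bounded_clinear shift"
  by (rule bounded_clinearI[where K = 1])
    (auto simp: norm_shift shift.rep_eq plus_ell2.rep_eq scaleC_ell2.rep_eq
      intro!: ell2_eqI split: nat.splits)

lemma bounded_clinear_backward_shift: "bounded_clinear backward_shift"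
  by (rule bounded_clinearI[where K = 1])
    (auto simp: norm_backward_shift backward_shift.rep_eq plus_ell2.rep_eq scaleC_ell2.rep_eq
      intro!: ell2_eqI)

lemma shift_basis: "shift (basis i) = basis (Suc i)"
  by (rule ell2_eqI) (auto simp: shift.rep_eq basis.rep_eq split: nat.splits)

lemma cadjoint_shift: "cadjoint shift = backward_shift"
proof (rule cadjoint_eqI)
  fix x y
  have "cinner (shift x) y = (\<Sum>\<^sub>\<infinity>n\<in>range Suc. coord (shift x) n * cnj (coord y n))"
    unfolding cinner_ell2.rep_eq
    by (rule infsum_cong_neutral) (auto simp: shift.rep_eq split: nat.splits)
  then show "cinner (shift x) y = cinner x (backward_shift y)"
    by (simp add: cinner_ell2.rep_eq infsum_reindex comp_def shift.rep_eq backward_shift.rep_eq)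
qed

lemma cadjoint_shift_basis:
  "cadjoint shift (basis (Suc i)) = basis i"
  "cadjoint shift (basis 0) = 0"
  by (auto intro!: ell2_eqI
      simp: cadjoint_shift backward_shift.rep_eq basis.rep_eq zero_ell2.rep_eq)

definition diagonal_operator :: "(nat \<Rightarrow> complex) \<Rightarrow> (nat ell2 \<Rightarrow> nat ell2) \<Rightarrow> bool" where
  "diagonal_operator \<mu> M \<longleftrightarrow> bounded_clinear M \<and> (\<forall>i. M (basis i) = \<mu> i *\<^sub>C basis i)"

section \<open>Tensor products\<close>

text \<open>
  The Hilbert space tensor product of two spaces of square-summable families is realised on
  the product index set, with simple tensors \<open>(u \<otimes> v)(i, j) = u i * v j\<close>. The lemmas
  \<open>cinner_tensor\<close> and \<open>closure_span_tensor\<close> are the two properties that determine the tensor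
  product up to unitary equivalence.
\<close>

lemma square_summable_tensor:
  "(\<lambda>(i, j). (cmod (coord u i * coord v j))\<^sup>2) summable_on UNIV"
proof -
  have "(\<lambda>(i, j). (cmod (coord u i))\<^sup>2 * (cmod (coord v j))\<^sup>2) summable_on UNIV \<times> UNIV"
    by (rule summable_on_SigmaI[where g = "\<lambda>i. (cmod (coord u i))\<^sup>2 * (norm v)\<^sup>2"])
      (auto intro!: has_sum_cmult_right has_sum_infsum summable_on_cmult_left coord_summable
        simp: norm_ell2_square)
  then show ?thesis by (simp add: norm_mult power_mult_distrib)
qed

lift_definition tensor :: "'i ell2 \<Rightarrow> 'j ell2 \<Rightarrow> ('i \<times> 'j) ell2" is
  "\<lambda>u v (i, j). u i * v j"
  subgoal for u v
    using square_summable_tensor[of "Abs_ell2 u" "Abs_ell2 v"]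
    by (simp add: Abs_ell2_inverse case_prod_unfold)
  done

lemma coord_tensor: "coord (tensor u v) (i, j) = coord u i * coord v j"
  by (simp add: tensor.rep_eq)

lemma tensor_basis: "tensor (basis i) (basis j) = basis (i, j)"
  by (rule ell2_eqI) (auto simp: tensor.rep_eq basis.rep_eq split: if_splits)

lemma tensor_scaleC_left: "tensor (c *\<^sub>C u) v = c *\<^sub>C tensor u v"
  by (rule ell2_eqI) (auto simp: tensor.rep_eq scaleC_ell2.rep_eq)

lemma cinner_tensor: "cinner (tensor u v) (tensor u' v') = cinner u u' * cinner v v'"
proof -
  have "cinner (tensor u v) (tensor u' v')
      = (\<Sum>\<^sub>\<infinity>(i, j)\<in>UNIV \<times> UNIV. coord u i * coord v j * cnj (coord u' i * coord v' j))"
    by (simp add: cinner_ell2.rep_eq tensor.rep_eq case_prod_unfold)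
  also have "\<dots> = (\<Sum>\<^sub>\<infinity>i. \<Sum>\<^sub>\<infinity>j. coord u i * coord v j * cnj (coord u' i * coord v' j))"
    using infsum_Sigma'_banach[of "\<lambda>i j. coord u i * coord v j * cnj (coord u' i * coord v' j)"
        UNIV "\<lambda>_. UNIV"] cinner_summable[of "tensor u v" "tensor u' v'"]
    by (simp add: tensor.rep_eq case_prod_unfold)
  also have "\<dots> = (\<Sum>\<^sub>\<infinity>i. \<Sum>\<^sub>\<infinity>j. (coord u i * cnj (coord u' i)) * (coord v j * cnj (coord v' j)))"
    by (simp add: mult_ac)
  finally show ?thesis
    by (simp add: cinner_ell2.rep_eq infsum_cmult_right' infsum_cmult_left')
qed

lemma closure_span_tensor: "closure (span (range (\<lambda>(u, v). tensor u v))) = UNIV"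
proof -
  have "x \<in> closure (span (range (\<lambda>(u, v). tensor u v)))" for x :: "('a \<times> 'b) ell2"
  proof (rule Lim_in_closed_set)
    show "((\<lambda>F. \<Sum>i\<in>F. coord x i *\<^sub>C basis i) \<longlongrightarrow> x) (finite_subsets_at_top UNIV)"
      using has_sum_basis[of x] by (simp add: has_sum_def)
    have "coord x i *\<^sub>C basis i \<in> range (\<lambda>(u, v). tensor u v)" for i
      by (rule range_eqI[where x = "(coord x i *\<^sub>C basis (fst i), basis (snd i))"])
        (simp add: tensor_scaleC_left tensor_basis)
    then have "(\<Sum>i\<in>F. coord x i *\<^sub>C basis i) \<in> span (range (\<lambda>(u, v). tensor u v))" for F
      by (meson span_sum span_base)
    then show "\<forall>\<^sub>F F in finite_subsets_at_top UNIV.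
        (\<Sum>i\<in>F. coord x i *\<^sub>C basis i) \<in> closure (span (range (\<lambda>(u, v). tensor u v)))"
      using closure_subset by (blast intro: always_eventually)
  qed auto
  then show ?thesis by blast
qed

definition tensor_op ::
  "('i ell2 \<Rightarrow> 'i ell2) \<Rightarrow> ('j ell2 \<Rightarrow> 'j ell2) \<Rightarrow> ('i \<times> 'j) ell2 \<Rightarrow> ('i \<times> 'j) ell2"
  where
  "tensor_op A B =
    (THE T. bounded_clinear T \<and> (\<forall>u v. T (tensor u v) = tensor (A u) (B v)))"

lift_definition flip :: "('i \<times> 'j) ell2 \<Rightarrow> ('j \<times> 'i) ell2" is "\<lambda>x (i, j). x (j, i)"
proof -
  fix x :: "'i \<times> 'j \<Rightarrow> complex" assume "(\<lambda>p. (cmod (x p))\<^sup>2) summable_on UNIV"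
  then have "((\<lambda>p. (cmod (x p))\<^sup>2) \<circ> prod.swap) summable_on UNIV"
    by (subst summable_on_reindex[symmetric]) auto
  then show "(\<lambda>p. (cmod (case p of (i, j) \<Rightarrow> x (j, i)))\<^sup>2) summable_on UNIV"
    by (simp add: comp_def case_prod_unfold prod.swap_def)
qed

lemma coord_flip: "coord (flip x) p = coord x (snd p, fst p)"
  by (simp add: flip.rep_eq case_prod_unfold)

lemma flip_tensor: "flip (tensor u v) = tensor v u"
  by (rule ell2_eqI) (auto simp: coord_flip coord_tensor)

lemma flip_flip: "flip (flip x) = x"
  by (rule ell2_eqI) (simp add: coord_flip)

lemma norm_flip: "norm (flip x) = norm x"
proof -
  have "(\<Sum>\<^sub>\<infinity>p\<in>range prod.swap. (cmod (coord x p))\<^sup>2) = (\<Sum>\<^sub>\<infinity>p. (cmod (coord (flip x) p))\<^sup>2)"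
    by (subst infsum_reindex) (auto simp: comp_def coord_flip prod.swap_def)
  then show ?thesis by (simp add: norm_ell2.rep_eq)
qed

lemma flip_add: "flip (x + y) = flip x + flip y"
  by (rule ell2_eqI) (simp add: coord_flip plus_ell2.rep_eq)

lemma flip_scaleC: "flip (c *\<^sub>C x) = c *\<^sub>C flip x"
  by (rule ell2_eqI) (simp add: coord_flip scaleC_ell2.rep_eq)

lemma flip_minus: "flip (- x) = - flip x"
  by (rule ell2_eqI) (simp add: coord_flip uminus_ell2.rep_eq)

lemma flip_diff: "flip (x - y) = flip x - flip y"
  by (rule ell2_eqI) (simp add: coord_flip minus_ell2.rep_eq)

lemma bounded_clinear_flip: "bounded_clinear flip"
  by (rule bounded_clinearI[where K = 1]) (simp_all add: flip_add flip_scaleC norm_flip)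

text \<open>Existence of the tensor product of bounded operators, via \<open>id \<otimes> B\<close>.\<close>

lift_definition slice :: "'i \<Rightarrow> ('i \<times> 'j) ell2 \<Rightarrow> 'j ell2" is "\<lambda>i x j. x (i, j)"
proof -
  fix i :: 'i and x :: "'i \<times> 'j \<Rightarrow> complex"
  assume "(\<lambda>p. (cmod (x p))\<^sup>2) summable_on UNIV"
  then have "(\<lambda>p. (cmod (x p))\<^sup>2) summable_on range (Pair i)"
    by (rule summable_on_subset_banach) simp
  then show "(\<lambda>j. (cmod (x (i, j)))\<^sup>2) summable_on UNIV"
    by (subst (asm) summable_on_reindex) (auto simp: comp_def inj_on_def)
qed

lemma sum_norm_slice_le:
  assumes "finite F"
  shows "(\<Sum>i\<in>F. (norm (slice i x))\<^sup>2) \<le> (norm x)\<^sup>2"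
proof -
  have s: "(\<lambda>p. (cmod (coord x p))\<^sup>2) summable_on F \<times> UNIV"
    by (rule summable_on_subset_banach[OF coord_summable]) simp
  have "(\<Sum>i\<in>F. (norm (slice i x))\<^sup>2) = (\<Sum>\<^sub>\<infinity>i\<in>F. \<Sum>\<^sub>\<infinity>j. (cmod (coord x (i, j)))\<^sup>2)"
    using assms by (simp add: norm_ell2_square slice.rep_eq)
  also have "\<dots> = (\<Sum>\<^sub>\<infinity>p\<in>F \<times> UNIV. (cmod (coord x p))\<^sup>2)"
    using infsum_Sigma_banach[OF s] by simp
  also have "\<dots> \<le> (norm x)\<^sup>2"
    unfolding norm_ell2_square by (rule infsum_mono_neutral[OF s coord_summable]) auto
  finally show ?thesis .
qed

lemma id_tensor_exists:
  fixes B :: "'j ell2 \<Rightarrow> 'j ell2"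
  assumes "bounded_clinear B"
  shows "\<exists>T :: ('i \<times> 'j) ell2 \<Rightarrow> ('i \<times> 'j) ell2.
    bounded_clinear T \<and> (\<forall>u v. T (tensor u v) = tensor u (B v))"
proof -
  obtain K where K: "\<And>x. norm (B x) \<le> norm x * K" "0 \<le> K"
    using assms bounded_linear.nonneg_bounded unfolding bounded_clinear_def by blast
  define g where "g x = (\<lambda>(i, j). coord (B (slice i x)) j)" for x :: "('i \<times> 'j) ell2"
  have bd: "L2_set (\<lambda>p. cmod (g x p)) F \<le> K * norm x" if "finite F" for F x
  proof -
    have "(\<Sum>p\<in>F. (cmod (g x p))\<^sup>2) \<le> (\<Sum>p\<in>fst ` F \<times> snd ` F. (cmod (g x p))\<^sup>2)"
      using that subset_fst_snd[of F] by (intro sum_mono2) auto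
    also have "\<dots> = (\<Sum>i\<in>fst ` F. \<Sum>j\<in>snd ` F. (cmod (coord (B (slice i x)) j))\<^sup>2)"
      by (simp add: sum.cartesian_product g_def case_prod_unfold)
    also have "\<dots> \<le> (\<Sum>i\<in>fst ` F. (norm (B (slice i x)))\<^sup>2)"
      unfolding norm_ell2_square
      by (intro sum_mono finite_sum_le_infsum coord_summable) (use that in auto)
    also have "\<dots> \<le> (\<Sum>i\<in>fst ` F. K\<^sup>2 * (norm (slice i x))\<^sup>2)"
    proof (rule sum_mono)
      show "(norm (B (slice i x)))\<^sup>2 \<le> K\<^sup>2 * (norm (slice i x))\<^sup>2" for i
        using power_mono[OF K(1)[of "slice i x"], of 2] by (simp add: power_mult_distrib mult.commute)
    qed
    also have "\<dots> \<le> K\<^sup>2 * (norm x)\<^sup>2"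
      using sum_norm_slice_le[of "fst ` F" x] that
      by (simp add: sum_distrib_left[symmetric] mult_left_mono)
    finally show ?thesis
      unfolding L2_set_def using K(2) by (intro real_le_lsqrt) (simp_all add: power_mult_distrib)
  qed
  define T where "T x = Abs_ell2 (g x)" for x
  have coT: "coord (T x) = g x" for x
  proof -
    have "(\<lambda>p. (cmod (g x p))\<^sup>2) summable_on UNIV"
      unfolding square_summable_iff using bd[of _ x] by blast
    then show ?thesis unfolding T_def by (simp add: Abs_ell2_inverse)
  qed
  have radd: "slice i (x + y) = slice i x + slice i y"
    and rscale: "slice i (c *\<^sub>C x) = c *\<^sub>C slice i x"
    and rtensor: "slice i (tensor u v) = coord u i *\<^sub>C v"
    for i c and x y :: "('i \<times> 'j) ell2" and u :: "'i ell2" and v :: "'j ell2"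
    by (auto intro!: ell2_eqI simp: slice.rep_eq plus_ell2.rep_eq scaleC_ell2.rep_eq coord_tensor)
  have Badd: "B (x + y) = B x + B y" and Bscale: "B (c *\<^sub>C x) = c *\<^sub>C B x" for x y c
    using assms by (auto simp: bounded_clinear_def linear_simps)
  have "bounded_clinear T"
  proof (rule bounded_clinearI[where K = K])
    show "T (x + y) = T x + T y" for x y
      by (rule ell2_eqI) (auto simp: coT g_def radd Badd plus_ell2.rep_eq)
    show "T (c *\<^sub>C x) = c *\<^sub>C T x" for c x
      by (rule ell2_eqI) (auto simp: coT g_def rscale Bscale scaleC_ell2.rep_eq)
    show "norm (T x) \<le> K * norm x" for x
      by (rule norm_ell2_leI) (simp add: coT bd)
  qed
  moreover have "T (tensor u v) = tensor u (B v)" for u v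
    by (rule ell2_eqI) (auto simp: coT g_def rtensor Bscale scaleC_ell2.rep_eq coord_tensor)
  ultimately show ?thesis by blast
qed

lemma bounded_clinear_compose:
  "bounded_clinear S \<Longrightarrow> bounded_clinear T \<Longrightarrow> bounded_clinear (\<lambda>x. S (T x))"
  by (simp add: bounded_clinear_def bounded_linear_compose)

lemma tensor_op_ex1:
  fixes A :: "'a ell2 \<Rightarrow> 'a ell2" and B :: "'b ell2 \<Rightarrow> 'b ell2"
  assumes "bounded_clinear A" "bounded_clinear B"
  shows "\<exists>!T. bounded_clinear T \<and> (\<forall>u v. T (tensor u v) = tensor (A u) (B v))"
proof (rule ex_ex1I)
  obtain T :: "('a \<times> 'b) ell2 \<Rightarrow> ('a \<times> 'b) ell2"
    where T: "bounded_clinear T" "\<And>u v. T (tensor u v) = tensor u (B v)"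
    using id_tensor_exists[OF assms(2)] by blast
  obtain U :: "('b \<times> 'a) ell2 \<Rightarrow> ('b \<times> 'a) ell2"
    where U: "bounded_clinear U" "\<And>u v. U (tensor u v) = tensor u (A v)"
    using id_tensor_exists[OF assms(1)] by blast
  have "bounded_clinear (\<lambda>x. flip (U (flip (T x))))"
    by (intro bounded_clinear_compose[OF bounded_clinear_flip]
        bounded_clinear_compose[OF U(1)] T(1))
  moreover have "flip (U (flip (T (tensor u v)))) = tensor (A u) (B v)" for u v
    by (simp add: T(2) U(2) flip_tensor)
  ultimately show "\<exists>T. bounded_clinear T \<and> (\<forall>u v. T (tensor u v) = tensor (A u) (B v))"
    by blast
next
  fix T T' :: "('a \<times> 'b) ell2 \<Rightarrow> ('a \<times> 'b) ell2"
  assume T: "bounded_clinear T \<and> (\<forall>u v. T (tensor u v) = tensor (A u) (B v))"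
    and T': "bounded_clinear T' \<and> (\<forall>u v. T' (tensor u v) = tensor (A u) (B v))"
  have "T (basis p) = T' (basis p)" for p
    using T T' by (cases p) (simp add: tensor_basis[symmetric])
  then show "T = T'" using T T' bounded_clinear_eqI by blast
qed

lemma
  fixes A :: "'i ell2 \<Rightarrow> 'i ell2" and B :: "'j ell2 \<Rightarrow> 'j ell2"
  assumes "bounded_clinear A" "bounded_clinear B"
  shows bounded_clinear_tensor_op: "bounded_clinear (tensor_op A B)"
    and tensor_op_tensor: "tensor_op A B (tensor u v) = tensor (A u) (B v)"
  using theI'[OF tensor_op_ex1[OF assms]] unfolding tensor_op_def by auto

lemma flip_tensor_op:
  fixes A :: "'a ell2 \<Rightarrow> 'a ell2" and B :: "'b ell2 \<Rightarrow> 'b ell2"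
  assumes "bounded_clinear A" "bounded_clinear B"
  shows "flip (tensor_op A B x) = tensor_op B A (flip x)"
proof -
  have "(\<lambda>x. flip (tensor_op A B x)) = (\<lambda>x. tensor_op B A (flip x))"
  proof (rule bounded_clinear_eqI)
    show "flip (tensor_op A B (basis p)) = tensor_op B A (flip (basis p))" for p
      by (cases p) (simp add: tensor_basis[symmetric] tensor_op_tensor flip_tensor assms)
  qed (rule bounded_clinear_compose[OF bounded_clinear_flip bounded_clinear_tensor_op[OF assms]]
        bounded_clinear_compose[OF bounded_clinear_tensor_op[OF assms(2,1)] bounded_clinear_flip])+
  then show ?thesis by (rule fun_cong)
qed

section \<open>Symmetric tensor products\<close>

typedef 'i sym_tensor = "{x :: ('i \<times> 'i) ell2. flip x = x}"
  morphisms of_sym Abs_sym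
  by (rule exI[of _ 0]) (auto intro!: ell2_eqI simp: coord_flip zero_ell2.rep_eq)

setup_lifting type_definition_sym_tensor

instantiation sym_tensor :: (type) complex_inner
begin

lift_definition zero_sym_tensor :: "'a sym_tensor" is 0
  by (auto intro!: ell2_eqI simp: coord_flip zero_ell2.rep_eq)
lift_definition plus_sym_tensor :: "'a sym_tensor \<Rightarrow> 'a sym_tensor \<Rightarrow> 'a sym_tensor" is "(+)"
  by (simp add: flip_add)
lift_definition uminus_sym_tensor :: "'a sym_tensor \<Rightarrow> 'a sym_tensor" is uminus
  by (simp add: flip_minus)
lift_definition minus_sym_tensor :: "'a sym_tensor \<Rightarrow> 'a sym_tensor \<Rightarrow> 'a sym_tensor" is "(-)"
  by (simp add: flip_diff)
lift_definition scaleR_sym_tensor :: "real \<Rightarrow> 'a sym_tensor \<Rightarrow> 'a sym_tensor" is "(*\<^sub>R)"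
  by (simp add: scaleC_of_real[symmetric] flip_scaleC)
lift_definition scaleC_sym_tensor :: "complex \<Rightarrow> 'a sym_tensor \<Rightarrow> 'a sym_tensor" is "(*\<^sub>C)"
  by (simp add: flip_scaleC)
lift_definition norm_sym_tensor :: "'a sym_tensor \<Rightarrow> real" is norm .
lift_definition cinner_sym_tensor :: "'a sym_tensor \<Rightarrow> 'a sym_tensor \<Rightarrow> complex" is cinner .
definition dist_sym_tensor :: "'a sym_tensor \<Rightarrow> 'a sym_tensor \<Rightarrow> real" where
  "dist_sym_tensor x y = norm (x - y)"
definition sgn_sym_tensor :: "'a sym_tensor \<Rightarrow> 'a sym_tensor" where
  "sgn_sym_tensor x = inverse (norm x) *\<^sub>R x"
definition uniformity_sym_tensor :: "('a sym_tensor \<times> 'a sym_tensor) filter" where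
  "uniformity_sym_tensor = (INF e\<in>{0 <..}. principal {(x, y). dist x y < e})"
definition open_sym_tensor :: "'a sym_tensor set \<Rightarrow> bool" where
  "open_sym_tensor U = (\<forall>x\<in>U. \<forall>\<^sub>F (x', y) in uniformity. x' = x \<longrightarrow> y \<in> U)"

instance
proof
  fix x y z :: "'a sym_tensor" and a b :: real and c d :: complex
  show "x + y + z = x + (y + z)" by transfer (simp add: add.assoc)
  show "x + y = y + x" by transfer (simp add: add.commute)
  show "0 + x = x" by transfer simp
  show "- x + x = 0" by transfer simp
  show "x - y = x + - y" by transfer simp
  show "a *\<^sub>R (x + y) = a *\<^sub>R x + a *\<^sub>R y" by transfer (rule scaleR_add_right)
  show "(a + b) *\<^sub>R x = a *\<^sub>R x + b *\<^sub>R x" by transfer (rule scaleR_add_left)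
  show "a *\<^sub>R b *\<^sub>R x = (a * b) *\<^sub>R x" by transfer simp
  show "1 *\<^sub>R x = x" by transfer simp
  show "dist x y = norm (x - y)" by (simp add: dist_sym_tensor_def)
  show "sgn x = inverse (norm x) *\<^sub>R x" by (simp add: sgn_sym_tensor_def)
  show "uniformity = (INF e\<in>{0 <..}. principal {(x, y :: 'a sym_tensor). dist x y < e})"
    by (simp add: uniformity_sym_tensor_def)
  show "open U = (\<forall>x\<in>U. \<forall>\<^sub>F (x', y) in uniformity. x' = x \<longrightarrow> y \<in> U)" for U :: "'a sym_tensor set"
    by (simp add: open_sym_tensor_def)
  show "norm x = 0 \<longleftrightarrow> x = 0" by transfer simp
  show "norm (x + y) \<le> norm x + norm y" by transfer (rule norm_triangle_ineq)
  show "norm (a *\<^sub>R x) = \<bar>a\<bar> * norm x" by transfer simp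
  show "c *\<^sub>C (x + y) = c *\<^sub>C x + c *\<^sub>C y" by transfer (rule scaleC_add_right)
  show "(c + d) *\<^sub>C x = c *\<^sub>C x + d *\<^sub>C x" by transfer (rule scaleC_add_left)
  show "c *\<^sub>C d *\<^sub>C x = (c * d) *\<^sub>C x" by transfer (rule scaleC_scaleC)
  show "complex_of_real a *\<^sub>C x = a *\<^sub>R x" by transfer (rule scaleC_of_real)
  show "cinner x y = cnj (cinner y x)" by transfer (rule cinner_commute)
  show "cinner (x + y) z = cinner x z + cinner y z" by transfer (rule cinner_add_left)
  show "cinner (c *\<^sub>C x) y = c * cinner x y" by transfer (rule cinner_scaleC_left)
  show "norm x = sqrt (Re (cinner x x))" by transfer (rule norm_eq_sqrt_cinner)
qed

end

instance sym_tensor :: (type) chilbert_space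
proof
  fix X :: "nat \<Rightarrow> 'a sym_tensor" assume C: "Cauchy X"
  have d: "dist x y = dist (of_sym x) (of_sym y)" for x y :: "'a sym_tensor"
    by (simp add: dist_norm norm_sym_tensor.rep_eq minus_sym_tensor.rep_eq)
  have "Cauchy (\<lambda>n. of_sym (X n))"
    using C by (simp add: Cauchy_def d)
  then obtain l where l: "(\<lambda>n. of_sym (X n)) \<longlonglongrightarrow> l"
    by (metis Cauchy_convergent convergent_def)
  have "(\<lambda>n. flip (of_sym (X n))) \<longlonglongrightarrow> flip l"
    using bounded_linear.tendsto[OF _ l] bounded_clinear_flip by (auto simp: bounded_clinear_def)
  moreover have "flip (of_sym (X n)) = of_sym (X n)" for n
    using of_sym by blast
  ultimately have "flip l = l" using l LIMSEQ_unique by simp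
  then have "of_sym (Abs_sym l) = l" by (simp add: Abs_sym_inverse)
  then have "X \<longlonglongrightarrow> Abs_sym l"
    using l by (simp add: tendsto_dist_iff[of X] tendsto_dist_iff[of "\<lambda>n. of_sym (X n)"] d)
  then show "convergent X" by (rule convergentI)
qed

text \<open>
  For bounded \<open>A\<close> and \<open>B\<close> the argument of \<open>Abs_sym\<close> below is symmetric; see
  \<open>of_sym_sym_tensor_op\<close>.
\<close>

definition sym_tensor_op ::
  "('i ell2 \<Rightarrow> 'i ell2) \<Rightarrow> ('i ell2 \<Rightarrow> 'i ell2) \<Rightarrow> 'i sym_tensor \<Rightarrow> 'i sym_tensor"
  (infixl "\<odot>" 70) where
  "(A \<odot> B) x = Abs_sym ((1 / 2) *\<^sub>C (tensor_op A B (of_sym x) + tensor_op B A (of_sym x)))"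

lemma of_sym_sym_tensor_op:
  assumes "bounded_clinear A" "bounded_clinear B"
  shows "of_sym ((A \<odot> B) x) =
    (1 / 2) *\<^sub>C (tensor_op A B (of_sym x) + tensor_op B A (of_sym x))"
proof -
  have "flip (of_sym x) = of_sym x" using of_sym by blast
  then show ?thesis
    unfolding sym_tensor_op_def
    by (subst Abs_sym_inverse)
      (simp_all add: flip_scaleC flip_add flip_tensor_op assms add.commute)
qed

lemma bounded_clinear_sym_tensor_op:
  assumes "bounded_clinear A" "bounded_clinear B"
  shows "bounded_clinear (A \<odot> B)"
proof -
  let ?T = "\<lambda>x. tensor_op A B x + tensor_op B A x"
  have "bounded_linear ?T"
    using bounded_clinear_tensor_op[OF assms] bounded_clinear_tensor_op[OF assms(2,1)]
    by (auto simp: bounded_clinear_def intro: bounded_linear_add)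
  then obtain K where K: "\<And>x. norm (?T x) \<le> norm x * K"
    using bounded_linear.bounded by blast
  have lin: "tensor_op A B (x + y) = tensor_op A B x + tensor_op A B y"
    "tensor_op B A (x + y) = tensor_op B A x + tensor_op B A y"
    "tensor_op A B (c *\<^sub>C x) = c *\<^sub>C tensor_op A B x"
    "tensor_op B A (c *\<^sub>C x) = c *\<^sub>C tensor_op B A x" for x y c
    using bounded_clinear_tensor_op[OF assms] bounded_clinear_tensor_op[OF assms(2,1)]
    by (auto simp: bounded_clinear_def linear_simps)
  show ?thesis
  proof (rule bounded_clinearI[where K = "K / 2"])
    show "(A \<odot> B) (x + y) = (A \<odot> B) x + (A \<odot> B) y" for x y
      by (simp add: of_sym_inject[symmetric] of_sym_sym_tensor_op assms plus_sym_tensor.rep_eq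
          lin scaleC_add_right add_ac)
    show "(A \<odot> B) (c *\<^sub>C x) = c *\<^sub>C (A \<odot> B) x" for c x
      by (simp add: of_sym_inject[symmetric] of_sym_sym_tensor_op assms scaleC_sym_tensor.rep_eq
          lin scaleC_add_right scaleC_scaleC mult.commute)
    show "norm ((A \<odot> B) x) \<le> K / 2 * norm x" for x
      using K[of "of_sym x"]
      by (simp add: norm_sym_tensor.rep_eq of_sym_sym_tensor_op assms norm_scaleC norm_divide
          mult.commute)
  qed
qed

end

theory Submission
  imports Defs
begin

text \<open>
  Write \<open>u \<odot> v = u \<otimes> v + v \<otimes> u\<close> and \<open>T = S\<^sup>* \<odot> M\<close>. On such vectors
  \<open>T (u \<odot> v) = (S\<^sup>*u \<odot> Mv + S\<^sup>*v \<odot> Mu) / 2\<close>. The vector \<open>e\<^sub>k \<odot> e\<^sub>k\<^sub>+\<^sub>1\<close> has norm \<open>\<surd>2\<close>, and the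
  \<open>(k, k)\<close> coordinate of its image is \<open>\<mu>\<^sub>k\<close>, which gives the lower bound. On symmetric vectors
  \<open>M \<otimes> S\<^sup>*\<close> is \<open>S\<^sup>* \<otimes> M\<close> followed by the flip, so \<open>\<parallel>Tx\<parallel> \<le> \<parallel>(S\<^sup>* \<otimes> M) x\<parallel>\<close>, which gives the
  upper bound. The lower bound is attained by \<open>M = diag(1, 0, 0, \<dots>)\<close>: then \<open>(S\<^sup>* \<otimes> M) x\<close> has
  the coordinates \<open>x(i + 1, 0)\<close>, each of which occurs twice in the symmetric \<open>x\<close>. With
  \<open>v = (1, q, q\<^sup>2, \<dots>)\<close>, so that \<open>S\<^sup>*v = q v\<close>, the vector \<open>v \<odot> v\<close> is an eigenvector of
  \<open>S\<^sup>* \<odot> I\<close> with eigenvalue \<open>q\<close>, so \<open>M = I\<close> attains the upper bound, and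
  \<open>e\<^sub>0 \<odot> v\<close> is an eigenvector of \<open>T\<close> with eigenvalue \<open>\<mu>\<^sub>0 q / 2\<close>.
\<close>

section \<open>Coordinates of bounded operators\<close>

lemma has_sum_coord_apply:
  assumes "bounded_clinear U"
  shows "((\<lambda>q. coord x q * coord (U (basis q)) p) has_sum coord (U x) p) UNIV"
proof -
  have "bounded_linear (\<lambda>y. coord (U y) p)"
  proof -
    have "bounded_linear (\<lambda>y. coord y p)"
      by (rule bounded_linear_intro[where K = 1])
        (simp_all add: plus_ell2.rep_eq scaleR_ell2.rep_eq scaleR_conv_of_real cmod_coord_le_norm)
    then show ?thesis
      using assms bounded_linear_compose unfolding bounded_clinear_def by blast
  qed
  from has_sum_bounded_linear[OF this has_sum_basis[of x]]
  show ?thesis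
    using assms by (simp add: bounded_clinear_def comp_def scaleC_ell2.rep_eq)
qed

text \<open>Row \<open>p\<close> of the matrix of \<open>U\<close> has at most one nonzero entry, in
  column \<open>r\<close>. Diagonal operators and \<open>S\<^sup>* \<otimes> M\<close> both have
  this shape, so their action on coordinates can be read off from basis vectors.\<close>

lemma coord_apply_single:
  assumes "bounded_clinear U" "\<And>q. q \<noteq> r \<Longrightarrow> coord (U (basis q)) p = 0"
  shows "coord (U x) p = coord x r * coord (U (basis r)) p"
proof -
  have "((\<lambda>q. coord x q * coord (U (basis q)) p) has_sum coord x r * coord (U (basis r)) p) UNIV"
    by (rule has_sum_finite_neutralI[of "{r}"]) (use assms in auto)
  then show ?thesis using has_sum_coord_apply[OF assms(1)] has_sum_unique by blast
qed

lemma coord_diagonal_operator: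
  assumes "diagonal_operator \<mu> M"
  shows "coord (M x) i = \<mu> i * coord x i"
  using assms coord_apply_single[of M i i x]
  by (auto simp: diagonal_operator_def scaleC_ell2.rep_eq basis.rep_eq mult.commute)

lemma coord_tensor_op_backward_shift:
  assumes "diagonal_operator \<mu> M"
  shows "coord (tensor_op backward_shift M x) (i, j) = \<mu> j * coord x (Suc i, j)"
proof -
  let ?T = "tensor_op backward_shift M"
  have M: "bounded_clinear M" "\<And>i. M (basis i) = \<mu> i *\<^sub>C basis i"
    using assms by (auto simp: diagonal_operator_def)
  have "coord (?T (basis (a, b))) (i, j) = (if a = Suc i \<and> b = j then \<mu> j else 0)" for a b
    unfolding tensor_basis[symmetric]
    by (auto simp: tensor_op_tensor bounded_clinear_backward_shift M coord_tensor
        backward_shift.rep_eq basis.rep_eq scaleC_ell2.rep_eq)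
  then show ?thesis
    by (subst coord_apply_single[of ?T "(Suc i, j)"])
      (auto split: if_splits simp: bounded_clinear_tensor_op bounded_clinear_backward_shift M)
qed

text \<open>Injectivity of \<open>f\<close> ensures that no coordinate of \<open>y\<close> is
  counted twice.\<close>

lemma norm_ell2_le_if_coord_le:
  assumes "\<And>i. cmod (coord x i) \<le> c * cmod (coord y (f i))" "inj f" "0 \<le> c"
  shows "norm x \<le> c * norm y"
proof (rule norm_ell2_leI)
  fix F :: "'a set" assume F: "finite F"
  have "L2_set (\<lambda>i. cmod (coord x i)) F \<le> L2_set (\<lambda>i. c * cmod (coord y (f i))) F"
    by (rule L2_set_mono) (use assms in auto)
  also have "\<dots> = c * L2_set (\<lambda>p. cmod (coord y p)) (f ` F)"
    using assms(3) inj_on_subset[OF assms(2), of F]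
    by (subst L2_set_right_distrib[symmetric]) (simp_all add: L2_set_def sum.reindex)
  also have "\<dots> \<le> c * norm y"
    using L2_set_le_norm[of "f ` F" y] F assms(3) by (simp add: mult_left_mono)
  finally show "L2_set (\<lambda>i. cmod (coord x i)) F \<le> c * norm y" .
qed

section \<open>Operator norms, diagonal entries and eigenvalues\<close>

lemma norm_basis [simp]: "norm (basis i) = 1"
proof -
  have "(\<Sum>\<^sub>\<infinity>j. (cmod (coord (basis i) j))\<^sup>2) = (\<Sum>\<^sub>\<infinity>j\<in>{i}. (cmod (coord (basis i) j))\<^sup>2)"
    by (rule infsum_cong_neutral) (auto simp: basis.rep_eq)
  then show ?thesis by (simp add: norm_ell2.rep_eq basis.rep_eq)
qed

lemma norm_le_onorm:
  "bounded_clinear T \<Longrightarrow> norm (T x) \<le> onorm T * norm x"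
  by (simp add: bounded_clinear_def onorm)

text \<open>Together with \<open>onorm_diagonal_le\<close>, this identifies \<open>onorm M\<close>
  as the supremum of the moduli of the diagonal entries.\<close>

lemma cmod_diagonal_le_onorm:
  assumes "diagonal_operator \<mu> M"
  shows "cmod (\<mu> i) \<le> onorm M"
  using norm_le_onorm[of M "basis i"] assms by (simp add: diagonal_operator_def norm_scaleC)

lemma onorm_diagonal_le:
  assumes "diagonal_operator \<mu> M" "\<And>i. cmod (\<mu> i) \<le> c"
  shows "onorm M \<le> c"
proof (rule onorm_bound)
  show "0 \<le> c" using assms(2)[of 0] norm_ge_zero order_trans by blast
  then show "norm (M x) \<le> c * norm x" for x
    by (intro norm_ell2_le_if_coord_le[where f = id])
      (auto simp: coord_diagonal_operator[OF assms(1)] norm_mult intro: mult_right_mono assms(2))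
qed

lemma cmod_eigenvalue_le_onorm:
  assumes "bounded_clinear T" "z \<in> point_spectrum T"
  shows "cmod z \<le> onorm T"
proof -
  obtain x where "x \<noteq> 0" "T x = z *\<^sub>C x" using assms(2) by (auto simp: point_spectrum_def)
  then show ?thesis using norm_le_onorm[OF assms(1), of x] by (simp add: norm_scaleC)
qed

section \<open>Geometric sequences and symmetrized simple tensors\<close>

text \<open>The eigenvector of the backward shift for \<open>q\<close>. It has the intended
  coordinates when \<open>cmod q < 1\<close>, where the powers are square-summable.\<close>

definition geometric :: "complex \<Rightarrow> nat ell2" where
  "geometric q = Abs_ell2 (\<lambda>n. q ^ n)"

lemma coord_geometric:
  assumes "cmod q < 1"
  shows "coord (geometric q) n = q ^ n"
proof -
  have "(cmod q)\<^sup>2 < 1" using assms by (simp add: power_less_one_iff abs_square_less_1)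
  then have "summable (\<lambda>n. ((cmod q)\<^sup>2) ^ n)" by (simp add: summable_geometric)
  then have "(\<lambda>n. (cmod (q ^ n))\<^sup>2) summable_on UNIV"
    by (subst summable_on_UNIV_nonneg_real_iff)
      (simp_all add: norm_power power_mult[symmetric] mult.commute)
  then show ?thesis by (simp add: geometric_def Abs_ell2_inverse)
qed

lemma backward_shift_geometric:
  "cmod q < 1 \<Longrightarrow> backward_shift (geometric q) = q *\<^sub>C geometric q"
  by (rule ell2_eqI) (simp add: backward_shift.rep_eq scaleC_ell2.rep_eq coord_geometric)

lift_definition sym_pair :: "'i ell2 \<Rightarrow> 'i ell2 \<Rightarrow> 'i sym_tensor" is
  "\<lambda>u v. tensor u v + tensor v u"
  by (simp add: flip_add flip_tensor add.commute)

lemma coord_sym_pair: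
  "coord (of_sym (sym_pair u v)) (i, j) = coord u i * coord v j + coord v i * coord u j"
  by (simp add: sym_pair.rep_eq plus_ell2.rep_eq coord_tensor)

lemma sym_tensor_eqI:
  "(\<And>i j. coord (of_sym x) (i, j) = coord (of_sym y) (i, j)) \<Longrightarrow> x = y"
  by (auto simp: of_sym_inject[symmetric] intro!: ell2_eqI)

lemma coord_of_sym_swap: "coord (of_sym x) (i, j) = coord (of_sym x) (j, i)"
proof -
  have "flip (of_sym x) = of_sym x" using of_sym by blast
  then show ?thesis using coord_flip[of "of_sym x" "(i, j)"] by (metis fst_conv snd_conv)
qed

lemma sym_tensor_op_sym_pair:
  assumes "bounded_clinear A" "bounded_clinear B"
  shows "(A \<odot> B) (sym_pair u v)
    = (1 / 2) *\<^sub>C (sym_pair (A u) (B v) + sym_pair (A v) (B u))"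
proof -
  have add: "U (x + y) = U x + U y" if "bounded_clinear U"
    for U :: "('a \<times> 'a) ell2 \<Rightarrow> ('a \<times> 'a) ell2" and x y
    using that by (auto simp: bounded_clinear_def linear_simps)
  show ?thesis
    by (simp add: of_sym_inject[symmetric] of_sym_sym_tensor_op assms sym_pair.rep_eq
        scaleC_sym_tensor.rep_eq plus_sym_tensor.rep_eq tensor_op_tensor
        add[OF bounded_clinear_tensor_op] add_ac)
qed

lemma sym_pair_basis_norm:
  assumes "i \<noteq> j"
  shows "norm (sym_pair (basis i) (basis j)) = sqrt 2"
proof -
  let ?x = "basis (i, j) + basis (j, i)"
  have "(\<Sum>\<^sub>\<infinity>p. (cmod (coord ?x p))\<^sup>2) = (\<Sum>\<^sub>\<infinity>p\<in>{(i, j), (j, i)}. (cmod (coord ?x p))\<^sup>2)"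
  proof (rule infsum_cong_neutral)
    fix p assume "p \<in> UNIV - {(i, j), (j, i)}"
    then have "p \<noteq> (i, j)" "p \<noteq> (j, i)" by blast+
    then show "(cmod (coord ?x p))\<^sup>2 = 0" by (simp add: basis.rep_eq plus_ell2.rep_eq)
  qed auto
  also have "\<dots> = 2" using assms by (simp add: basis.rep_eq plus_ell2.rep_eq)
  finally show ?thesis
    by (simp add: norm_sym_tensor.rep_eq sym_pair.rep_eq tensor_basis norm_ell2.rep_eq)
qed

section \<open>Norm bounds and the extremal example for the lower one\<close>

text \<open>Averaging a vector with its image under the isometric flip does not increase the norm.
  This serves both the upper bound and the sharpness of the lower bound.\<close>

lemma norm_backward_shift_sym_le:
  assumes "diagonal_operator \<mu> M"
  shows "norm ((backward_shift \<odot> M) x) \<le> norm (tensor_op backward_shift M (of_sym x))"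
proof -
  have M: "bounded_clinear M" using assms by (simp add: diagonal_operator_def)
  let ?A = "tensor_op backward_shift M (of_sym x)"
  have "flip ?A = tensor_op M backward_shift (of_sym x)"
    using flip_tensor_op[OF bounded_clinear_backward_shift M, of "of_sym x"] of_sym[of x] by simp
  then have "norm ((backward_shift \<odot> M) x) = norm (?A + flip ?A) / 2"
    by (simp add: norm_sym_tensor.rep_eq of_sym_sym_tensor_op bounded_clinear_backward_shift M
        norm_scaleC norm_divide)
  also have "\<dots> \<le> norm ?A"
    using norm_triangle_ineq[of ?A "flip ?A"] by (simp add: norm_flip)
  finally show ?thesis .
qed

lemma onorm_backward_shift_sym_le:
  assumes "diagonal_operator \<mu> M"
  shows "onorm (backward_shift \<odot> M) \<le> onorm M"
proof (rule onorm_bound)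
  show M0: "0 \<le> onorm M"
    using assms by (auto simp: diagonal_operator_def bounded_clinear_def intro: onorm_pos_le)
  fix x :: "nat sym_tensor"
  \<comment> \<open>The coordinate at \<open>(i, j)\<close> is the one of \<open>x\<close> at
    \<open>(Suc i, j)\<close>, weighted by \<open>\<mu> j\<close>.\<close>
  have "norm (tensor_op backward_shift M (of_sym x)) \<le> onorm M * norm (of_sym x)"
  proof (rule norm_ell2_le_if_coord_le[where f = "map_prod Suc id"])
    show "cmod (coord (tensor_op backward_shift M (of_sym x)) p)
        \<le> onorm M * cmod (coord (of_sym x) (map_prod Suc id p))" for p
      by (cases p) (simp add: coord_tensor_op_backward_shift[OF assms] norm_mult mult_right_mono
          cmod_diagonal_le_onorm[OF assms])
  qed (use M0 in \<open>auto intro: prod.inj_map\<close>)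
  then show "norm ((backward_shift \<odot> M) x) \<le> onorm M * norm x"
    using norm_backward_shift_sym_le[OF assms, of x] by (simp add: norm_sym_tensor.rep_eq)
qed

lemma onorm_backward_shift_sym_ge:
  assumes "diagonal_operator \<mu> M"
  shows "1 / sqrt 2 * onorm M \<le> onorm (backward_shift \<odot> M)"
proof -
  have M: "bounded_clinear M" "\<And>i. M (basis i) = \<mu> i *\<^sub>C basis i"
    using assms by (auto simp: diagonal_operator_def)
  let ?T = "backward_shift \<odot> M"
  have "cmod (\<mu> k) \<le> sqrt 2 * onorm ?T" for k
  proof -
    let ?x = "sym_pair (basis k) (basis (Suc k))"
    \<comment> \<open>Only the pair of
      \<open>S\<^sup>* e\<^sub>k\<^sub>+\<^sub>1 = e\<^sub>k\<close> with \<open>M e\<^sub>k\<close>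
      meets this position; it contributes \<open>2 * \<mu> k\<close>, which the factor 1/2
      halves.\<close>
    have "coord (of_sym (?T ?x)) (k, k) = \<mu> k"
      by (simp add: sym_tensor_op_sym_pair bounded_clinear_backward_shift M
          scaleC_sym_tensor.rep_eq plus_sym_tensor.rep_eq scaleC_ell2.rep_eq plus_ell2.rep_eq
          coord_sym_pair backward_shift.rep_eq basis.rep_eq)
    then have "cmod (\<mu> k) \<le> norm (?T ?x)"
      using cmod_coord_le_norm[of "of_sym (?T ?x)" "(k, k)"] by (simp add: norm_sym_tensor.rep_eq)
    also have "\<dots> \<le> onorm ?T * norm ?x"
      by (intro norm_le_onorm bounded_clinear_sym_tensor_op bounded_clinear_backward_shift M)
    finally show ?thesis by (simp add: sym_pair_basis_norm mult.commute)
  qed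
  from onorm_diagonal_le[OF assms this] show ?thesis by (simp add: field_simps)
qed

lemma backward_shift_sym_lower_sharp:
  assumes "diagonal_operator (\<lambda>i. if i = 0 then 1 else 0) N"
  shows "onorm (backward_shift \<odot> N) \<le> 1 / sqrt 2"
proof (rule onorm_bound)
  fix x :: "nat sym_tensor"
  let ?x = "coord (of_sym x)" and ?A = "tensor_op backward_shift N (of_sym x)"
  have "norm ?A \<le> norm x / sqrt 2"
  proof (rule norm_ell2_leI)
    fix F :: "(nat \<times> nat) set" assume F: "finite F"
    \<comment> \<open>All diagonal entries except the first vanish, so only positions with second
      index 0 contribute.\<close>
    define I where "I = {i. (i, 0) \<in> F}"
    \<comment> \<open>The source positions and their mirror images. The shift keeps them off the
      diagonal, so the two sets are disjoint and symmetry makes every value occur twice; hence the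
      factor \<open>1 / sqrt 2\<close>.\<close>
    define G where "G = (\<lambda>i. (Suc i, 0::nat)) ` I"
    define G' where "G' = (\<lambda>i. (0::nat, Suc i)) ` I"
    have "I \<subseteq> fst ` F" unfolding I_def by force
    then have fin: "finite I" using F finite_subset by blast
    have "(\<Sum>p\<in>F. (cmod (coord ?A p))\<^sup>2)
        = (\<Sum>p\<in>(\<lambda>i. (i, 0)) ` I. (cmod (coord ?A p))\<^sup>2)"
      using F by (intro sum.mono_neutral_right)
        (auto simp: I_def coord_tensor_op_backward_shift[OF assms])
    also have "\<dots> = (\<Sum>i\<in>I. (cmod (?x (Suc i, 0)))\<^sup>2)"
      by (simp add: sum.reindex inj_on_def coord_tensor_op_backward_shift[OF assms])
    finally have A: "(\<Sum>p\<in>F. (cmod (coord ?A p))\<^sup>2) = (\<Sum>i\<in>I. (cmod (?x (Suc i, 0)))\<^sup>2)" .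
    have "2 * (\<Sum>i\<in>I. (cmod (?x (Suc i, 0)))\<^sup>2)
        = (\<Sum>p\<in>G. (cmod (?x p))\<^sup>2) + (\<Sum>p\<in>G'. (cmod (?x p))\<^sup>2)"
      using coord_of_sym_swap[of x 0]
      by (simp add: G_def G'_def sum.reindex inj_on_def)
    also have "\<dots> = (\<Sum>p\<in>G \<union> G'. (cmod (?x p))\<^sup>2)"
      by (rule sum.union_disjoint[symmetric]) (auto simp: G_def G'_def fin)
    also have "\<dots> \<le> (norm x)\<^sup>2"
      unfolding norm_sym_tensor.rep_eq norm_ell2_square
      by (rule finite_sum_le_infsum[OF coord_summable]) (auto simp: G_def G'_def fin)
    finally have "(\<Sum>p\<in>F. (cmod (coord ?A p))\<^sup>2) \<le> (norm x / sqrt 2)\<^sup>2"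
      unfolding A by (simp add: power_divide)
    then show "L2_set (\<lambda>p. cmod (coord ?A p)) F \<le> norm x / sqrt 2"
      unfolding L2_set_def by (intro real_le_lsqrt) (simp_all add: sum_nonneg)
  qed
  then show "norm ((backward_shift \<odot> N) x) \<le> 1 / sqrt 2 * norm x"
    using norm_backward_shift_sym_le[OF assms, of x] by simp
qed simp

section \<open>Eigenvectors built from geometric sequences\<close>

lemma backward_shift_sym_id_eigenvalue:
  assumes "cmod q < 1"
  shows "q \<in> point_spectrum (backward_shift \<odot> (\<lambda>x. x))"
proof -
  let ?x = "sym_pair (geometric q) (geometric q)"
  have id: "bounded_clinear (\<lambda>x :: nat ell2. x)"
    by (rule bounded_clinearI[where K = 1]) auto
  have "coord (of_sym ?x) (0, 0) \<noteq> coord (of_sym 0) (0, 0)"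
    by (simp add: coord_sym_pair coord_geometric assms zero_sym_tensor.rep_eq zero_ell2.rep_eq)
  then have "?x \<noteq> 0" by metis
  moreover have "(backward_shift \<odot> (\<lambda>x. x)) ?x = q *\<^sub>C ?x"
    by (rule sym_tensor_eqI)
      (simp add: sym_tensor_op_sym_pair bounded_clinear_backward_shift id
        scaleC_sym_tensor.rep_eq plus_sym_tensor.rep_eq scaleC_ell2.rep_eq plus_ell2.rep_eq
        coord_sym_pair backward_shift_geometric assms algebra_simps)
  ultimately show ?thesis unfolding point_spectrum_def by blast
qed

text \<open>Since \<open>S\<^sup>*\<close> kills \<open>e\<^sub>0\<close>, only the pair of
  \<open>S\<^sup>* v = q v\<close> with \<open>M e\<^sub>0 = \<mu>\<^sub>0 e\<^sub>0\<close>
  survives. The case \<open>q = 0\<close> puts 0 in the point spectrum for every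
  \<open>\<mu>\<close>.\<close>

lemma backward_shift_sym_eigenvalue:
  assumes "diagonal_operator \<mu> M" "cmod q < 1"
  shows "\<mu> 0 * q / 2 \<in> point_spectrum (backward_shift \<odot> M)"
proof -
  have M: "bounded_clinear M" "\<And>i. M (basis i) = \<mu> i *\<^sub>C basis i"
    using assms by (auto simp: diagonal_operator_def)
  have S0: "backward_shift (basis 0) = 0"
    using cadjoint_shift_basis(2) by (simp add: cadjoint_shift)
  let ?x = "sym_pair (basis 0) (geometric q)"
  have "coord (of_sym ?x) (0, 0) \<noteq> coord (of_sym 0) (0, 0)"
    by (simp add: coord_sym_pair coord_geometric assms basis.rep_eq zero_sym_tensor.rep_eq
        zero_ell2.rep_eq)
  then have "?x \<noteq> 0" by metis
  moreover have "(backward_shift \<odot> M) ?x = (\<mu> 0 * q / 2) *\<^sub>C ?x"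
    by (rule sym_tensor_eqI)
      (simp add: sym_tensor_op_sym_pair bounded_clinear_backward_shift M S0
        scaleC_sym_tensor.rep_eq plus_sym_tensor.rep_eq scaleC_ell2.rep_eq plus_ell2.rep_eq
        zero_ell2.rep_eq coord_sym_pair backward_shift_geometric assms algebra_simps)
  ultimately show ?thesis unfolding point_spectrum_def by blast
qed

theorem theorem9p19:
  fixes \<mu> :: "nat \<Rightarrow> complex" and M :: "nat ell2 \<Rightarrow> nat ell2"
  assumes "diagonal_operator \<mu> M"
  shows "1 / sqrt 2 * onorm M \<le> onorm (cadjoint shift \<odot> M)
      \<and> onorm (cadjoint shift \<odot> M) \<le> onorm M
      \<and> (\<exists>\<nu> N. diagonal_operator \<nu> N \<and> N \<noteq> (\<lambda>_. 0)
            \<and> onorm (cadjoint shift \<odot> N) = 1 / sqrt 2 * onorm N)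
      \<and> (\<exists>\<nu> N. diagonal_operator \<nu> N \<and> N \<noteq> (\<lambda>_. 0)
            \<and> onorm (cadjoint shift \<odot> N) = onorm N)
      \<and> {z. cmod z < 1 / 2 * cmod (\<mu> 0)} \<union> {0} \<subseteq> point_spectrum (cadjoint shift \<odot> M)"
  unfolding cadjoint_shift
proof (intro conjI)
  show "1 / sqrt 2 * onorm M \<le> onorm (backward_shift \<odot> M)"
    by (rule onorm_backward_shift_sym_ge[OF assms])
  show "onorm (backward_shift \<odot> M) \<le> onorm M"
    by (rule onorm_backward_shift_sym_le[OF assms])
  have basis0: "basis 0 \<noteq> (0 :: nat ell2)"
    using norm_basis[of "0::nat"] by force
  show "\<exists>\<nu> N. diagonal_operator \<nu> N \<and> N \<noteq> (\<lambda>_. 0)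
      \<and> onorm (backward_shift \<odot> N) = 1 / sqrt 2 * onorm N"
  proof (intro exI conjI)
    let ?\<nu> = "\<lambda>i::nat. if i = 0 then 1 else 0 :: complex"
    let ?N = "\<lambda>x :: nat ell2. coord x 0 *\<^sub>C basis (0::nat)"
    have "bounded_clinear ?N"
      by (rule bounded_clinearI[where K = 1])
        (simp_all add: plus_ell2.rep_eq scaleC_ell2.rep_eq scaleC_add_left scaleC_scaleC
          norm_scaleC cmod_coord_le_norm)
    then show N: "diagonal_operator ?\<nu> ?N"
      by (simp add: diagonal_operator_def basis.rep_eq)
    have "?N (basis 0) \<noteq> 0" using basis0 by (simp add: basis.rep_eq)
    then show "?N \<noteq> (\<lambda>_. 0)" by metis
    have "onorm (backward_shift \<odot> ?N) \<le> 1 / sqrt 2"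
      by (rule backward_shift_sym_lower_sharp[OF N])
    also have "\<dots> \<le> 1 / sqrt 2 * onorm ?N"
      using cmod_diagonal_le_onorm[OF N, of 0] by (simp add: divide_right_mono)
    finally show "onorm (backward_shift \<odot> ?N) = 1 / sqrt 2 * onorm ?N"
      using onorm_backward_shift_sym_ge[OF N] by linarith
  qed
  show "\<exists>\<nu> N. diagonal_operator \<nu> N \<and> N \<noteq> (\<lambda>_. 0) \<and> onorm (backward_shift \<odot> N) = onorm N"
  proof (intro exI conjI)
    let ?I = "\<lambda>x :: nat ell2. x"
    have I: "bounded_clinear ?I" by (rule bounded_clinearI[where K = 1]) auto
    then show D: "diagonal_operator (\<lambda>_. 1) ?I" by (simp add: diagonal_operator_def)
    show "?I \<noteq> (\<lambda>_. 0)" using basis0 by metis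
    \<comment> \<open>The eigenvalues found fill the open unit disc only, so the norm 1 is
      approached from below through real eigenvalues \<open>r < 1\<close>.\<close>
    have "r \<le> onorm (backward_shift \<odot> ?I)" if "0 < r" "r < 1" for r
      using cmod_eigenvalue_le_onorm[OF bounded_clinear_sym_tensor_op
          [OF bounded_clinear_backward_shift I] backward_shift_sym_id_eigenvalue[of "of_real r"]]
        that by simp
    then have "1 \<le> onorm (backward_shift \<odot> ?I)" by (intro dense_le_bounded[of 0 1]) auto
    moreover have "onorm ?I \<le> 1" by (rule onorm_diagonal_le[OF D]) simp
    ultimately show "onorm (backward_shift \<odot> ?I) = onorm ?I"
      using onorm_backward_shift_sym_le[OF D] by linarith
  qed
  show "{z. cmod z < 1 / 2 * cmod (\<mu> 0)} \<union> {0} \<subseteq> point_spectrum (backward_shift \<odot> M)"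
  proof
    fix z assume z: "z \<in> {z. cmod z < 1 / 2 * cmod (\<mu> 0)} \<union> {0}"
    \<comment> \<open>If \<open>\<mu> 0 = 0\<close>, then \<open>z = 0\<close> and this quotient is \<open>0\<close>, as needed.\<close>
    define q where "q = 2 * z / \<mu> 0"
    have "cmod q < 1"
    proof (cases "\<mu> 0 = 0")
      case False
      then show ?thesis using z by (auto simp: q_def norm_mult norm_divide divide_simps)
    qed (simp add: q_def)
    moreover have "\<mu> 0 * q / 2 = z" using z by (auto simp: q_def)
    ultimately show "z \<in> point_spectrum (backward_shift \<odot> M)"
      using backward_shift_sym_eigenvalue[OF assms, of q] by simp
  qed
qed

end
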